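(* Let $\lambda,\mu,\nu\in\mathcal{P}_d$. If $L\in\mathcal{LR}_{\lambda,\mu}^{\nu}$, then $c_L\geq 0$.
   Context: Fix a positive integer $d$. $\mathbb{N}$ is the set of nonnegative integers; for an integer $m$, $m':=d+1-m$. $\mathcal{P}_d$ is the set of partitions $\lambda=(\lambda_1\geq\cdots\geq\lambda_d)\in\mathbb{N}^d$. For a finite sequence with terms in $\{1,\ldots,d\}$, its content is $\omega=(\xi_1,\ldots,\xi_d)\in\mathbb{N}^d$, where $\xi_k$ is the number of $k$'s in the sequence. $(y_i)_{i\geq1}$ are independent variables. To $\mu\in\mathcal{P}_d$ associate its reverse Young diagram, the right- and bottom-justified array of boxes whose bottom row has length $\mu_1$, next-to-bottom row length $\mu_2$, etc. Rows are numbered $1,2,\ldots$ from bottom to top and columns $1,2,\ldots$ from right to left; $r(a)$ and $c(a)$ are the row and column numbers of (the box of) an entry $a$ in $\mu$. The skew diagram $\lambda*\mu$ is obtained by placing the ordinary (top-left justified) Young diagram $\lambda$ above and to the right of the reverse Young diagram $\mu$ (so no box of $\lambda$ shares a row or column with a box of $\mu$). A skew barred tableau $L$ of shape $\lambda*\mu$ fills each box of $\lambda$ with an element of $\{1,\ldots,d\}$ and each box of $\mu$ with an element of $\{1,\ldots,d\}\cup\{\bar1,\ldots,\bar d\}$ so that the values, disregarding bars, weakly increase along rows from left to right and strictly increase down columns. $|a|$ denotes the integer value of an entry $a$ (bar disregarded). The unbarred column word $L^u$ is the sequence of unbarred entries of $L$ read column by column, starting with the rightmost column and moving left, each column read from top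 to bottom, barred entries being skipped. It is Yamanouchi if every initial segment contains at least as many $k$'s as $(k+1)$'s for each $k=1,\ldots,d-1$. $\mathcal{LR}_{\lambda,\mu}^{\nu}$ is the set of skew barred tableaux of shape $\lambda*\mu$ whose unbarred column word is Yamanouchi with $\omega(L^u)=\nu$. For $a\in L$, $L^u_{<a}$ is the portion of the unbarred column word that comes before reaching $a$ in the reading order. Set $$c_L=\prod_{a\in L,\ a\text{ barred}}\left(y_{|a|'+\omega(L^u_{<a})_{|a|}}-y_{|a|'+c(a)-r(a)}\right)$$ (empty product $=1$). We write $c_L>0$ if each factor in this product is of the form $y_i-y_j$ with $i>j$, and $c_L\geq0$ if either $c_L>0$ or $c_L=0$. *)

theory Defs
  imports Main "HOL-Library.FuncSet" "HOL-Library.Poly_Mapping"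
begin

definition partitions :: "nat \<Rightarrow> nat list set" where
  "partitions d = {lam. length lam = d \<and> sorted_wrt (\<ge>) lam}"

text \<open>Terms of elements of $\mathbb{N}^d$ are numbered from 1.\<close>

definition part :: "nat list \<Rightarrow> nat \<Rightarrow> nat" where
  "part lam i = lam ! (i - 1)"

definition word_content :: "nat \<Rightarrow> nat list \<Rightarrow> nat list" where
  "word_content d w = map (count_list w) [1..<d + 1]"

definition yamanouchi :: "nat \<Rightarrow> nat list \<Rightarrow> bool" where
  "yamanouchi d w \<longleftrightarrow>
     (\<forall>n\<le>length w. \<forall>k. 1 \<le> k \<and> k \<le> d - 1 \<longrightarrow>
        part (word_content d (take n w)) (k + 1) \<le> part (word_content d (take n w)) k)"

text \<open>
  A box is a pair (row, column) of integers, with rows increasing downwards and columns increasing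
  to the right. The reverse diagram of \<open>mu\<close> lies in rows \<open>-d, \<dots>, -1\<close> and in negative columns, so
  that the box in row \<open>r\<close> (from the bottom) and column \<open>c\<close> (from the right) is \<open>(- r, - c)\<close>. The
  diagram of \<open>lam\<close> lies in rows \<open>-2d, \<dots>, -d - 1\<close> and in positive columns, hence above and to the right
  of it. Only the relative position of boxes matters; some rows and columns may be empty.
\<close>

type_synonym box = "int \<times> int"

definition upper_boxes :: "nat \<Rightarrow> nat list \<Rightarrow> box set" where
  "upper_boxes d lam =
     {(int i - 2 * int d - 1, int j) | i j. 1 \<le> i \<and> i \<le> d \<and> 1 \<le> j \<and> j \<le> part lam i}"

definition lower_boxes :: "nat \<Rightarrow> nat list \<Rightarrow> box set" where
  "lower_boxes d mu = {(- int r, - int c) | r c. 1 \<le> r \<and> r \<le> d \<and> 1 \<le> c \<and> c \<le> part mu r}"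

definition row_num :: "box \<Rightarrow> int" where
  "row_num b = - fst b"

definition col_num :: "box \<Rightarrow> int" where
  "col_num b = - snd b"

definition skew_boxes :: "nat \<Rightarrow> nat list \<Rightarrow> nat list \<Rightarrow> box set" where
  "skew_boxes d lam mu = upper_boxes d lam \<union> lower_boxes d mu"

datatype entry = Unbarred nat | Barred nat

fun val :: "entry \<Rightarrow> nat" where
  "val (Unbarred k) = k"
| "val (Barred k) = k"

fun is_barred :: "entry \<Rightarrow> bool" where
  "is_barred (Unbarred k) = False"
| "is_barred (Barred k) = True"

type_synonym filling = "box \<Rightarrow> entry"

definition skew_barred_tableaux :: "nat \<Rightarrow> nat list \<Rightarrow> nat list \<Rightarrow> filling set" where
  "skew_barred_tableaux d lam mu =
     {L \<in> (\<Pi>\<^sub>E b \<in> skew_boxes d lam mu.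
             if b \<in> upper_boxes d lam then Unbarred ` {1..d}
             else Unbarred ` {1..d} \<union> Barred ` {1..d}).
        (\<forall>p q q'. (p, q) \<in> skew_boxes d lam mu \<and> (p, q') \<in> skew_boxes d lam mu \<and> q < q' \<longrightarrow>
           val (L (p, q)) \<le> val (L (p, q'))) \<and>
        (\<forall>p p' q. (p, q) \<in> skew_boxes d lam mu \<and> (p', q) \<in> skew_boxes d lam mu \<and> p < p' \<longrightarrow>
           val (L (p, q)) < val (L (p', q)))}"

text \<open>
  All boxes of the shape, column by column from right to left, each column from top to bottom. The
  ranges of \<open>q\<close> and \<open>p\<close> are those of the columns and rows occupied by the two diagrams.
\<close>

definition reading_order :: "nat \<Rightarrow> nat list \<Rightarrow> nat list \<Rightarrow> box list" where
  "reading_order d lam mu =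
     [(p, q). q \<leftarrow> rev [- int (part mu 1)..int (part lam 1)], p \<leftarrow> [- 2 * int d..- 1],
        (p, q) \<in> skew_boxes d lam mu]"

definition unbarred_word :: "filling \<Rightarrow> box list \<Rightarrow> nat list" where
  "unbarred_word L bs = [k. Unbarred k \<leftarrow> map L bs]"

definition unbarred_column_word :: "nat \<Rightarrow> nat list \<Rightarrow> nat list \<Rightarrow> filling \<Rightarrow> nat list" where
  "unbarred_column_word d lam mu L = unbarred_word L (reading_order d lam mu)"

text \<open>An entry of \<open>L\<close> is referred to by its box.\<close>

definition unbarred_column_word_before ::
  "nat \<Rightarrow> nat list \<Rightarrow> nat list \<Rightarrow> filling \<Rightarrow> box \<Rightarrow> nat list" where
  "unbarred_column_word_before d lam mu L b =
     unbarred_word L (takeWhile (\<lambda>b'. b' \<noteq> b) (reading_order d lam mu))"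

definition LR :: "nat \<Rightarrow> nat list \<Rightarrow> nat list \<Rightarrow> nat list \<Rightarrow> filling set" where
  "LR d lam mu nu =
     {L \<in> skew_barred_tableaux d lam mu.
        yamanouchi d (unbarred_column_word d lam mu L) \<and>
        word_content d (unbarred_column_word d lam mu L) = nu}"

text \<open>
  Polynomials with integer coefficients in independent variables \<open>var_y i\<close>, as finitely supported
  functions from exponent vectors to coefficients. The variables are indexed by all integers because
  the index \<open>|a|' + c(a) - r(a)\<close> involves a difference, but for a barred entry of a tableau both
  indices are at least 1: the \<open>r(a) - 1\<close> boxes below \<open>a\<close> have increasing values, so
  \<open>|a|' \<ge> r(a)\<close>.
\<close>

type_synonym ypoly = "(int \<Rightarrow>\<^sub>0 nat) \<Rightarrow>\<^sub>0 int"

definition var_y :: "int \<Rightarrow> ypoly" where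
  "var_y i = Poly_Mapping.single (Poly_Mapping.single i 1) 1"

definition dual_index :: "nat \<Rightarrow> int \<Rightarrow> int" where
  "dual_index d m = int d + 1 - m"

definition barred_boxes :: "nat \<Rightarrow> nat list \<Rightarrow> nat list \<Rightarrow> filling \<Rightarrow> box set" where
  "barred_boxes d lam mu L = {b \<in> skew_boxes d lam mu. is_barred (L b)}"

definition c_factor :: "nat \<Rightarrow> nat list \<Rightarrow> nat list \<Rightarrow> filling \<Rightarrow> box \<Rightarrow> ypoly" where
  "c_factor d lam mu L b =
     var_y (dual_index d (int (val (L b))) +
        int (part (word_content d (unbarred_column_word_before d lam mu L b)) (val (L b)))) -
     var_y (dual_index d (int (val (L b))) + col_num b - row_num b)"

definition c_poly :: "nat \<Rightarrow> nat list \<Rightarrow> nat list \<Rightarrow> filling \<Rightarrow> ypoly" where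
  "c_poly d lam mu L = (\<Prod>b\<in>barred_boxes d lam mu L. c_factor d lam mu L b)"

text \<open>
  Positivity is a condition on the individual factors of the defining product, hence a predicate
  on \<open>L\<close> rather than on the polynomial.
\<close>

definition c_positive :: "nat \<Rightarrow> nat list \<Rightarrow> nat list \<Rightarrow> filling \<Rightarrow> bool" where
  "c_positive d lam mu L \<longleftrightarrow>
     (\<forall>b\<in>barred_boxes d lam mu L. \<exists>i j. 1 \<le> j \<and> j < i \<and> c_factor d lam mu L b = var_y i - var_y j)"

definition c_nonneg :: "nat \<Rightarrow> nat list \<Rightarrow> nat list \<Rightarrow> filling \<Rightarrow> bool" where
  "c_nonneg d lam mu L \<longleftrightarrow> c_positive d lam mu L \<or> c_poly d lam mu L = 0"

end

theory Submission
  imports Defs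
begin

text \<open>
  For a box \<open>b\<close> of the lower diagram, call \<open>\<omega>(L\<^sup>u\<^sub><\<^sub>b)\<^bsub>|b|\<^esub> + r(b) - c(b)\<close> its excess. The factor of a
  barred entry is \<open>y\<^sub>i - y\<^sub>j\<close> where \<open>i - j\<close> is the excess, so it is positive, zero or negative
  according to the sign of the excess. The claim is that a barred entry with negative excess forces
  a barred entry with excess \<open>0\<close> in the same row, which makes the whole product vanish.

  This is a discrete intermediate value argument along the row. In the rightmost column the excess
  is at least \<open>r - 1 \<ge> 0\<close>. Let \<open>b\<close> be the left neighbour of \<open>a\<close>. Since \<open>|b| \<le> |a|\<close>, the Yamanouchi
  property at the moment \<open>b\<close> is reached gives at least as many \<open>|b|\<close>'s as \<open>|a|\<close>'s, and \<open>a\<close> has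
  been read by then; hence the excess falls by at most 1 on passing from \<open>a\<close> to \<open>b\<close>, and does not
  fall at all if \<open>a\<close> is unbarred (lemma \<open>excess_left_neighbour\<close>). A row that reaches a negative
  value therefore passes through \<open>0\<close> immediately before first becoming negative, and it does so at
  a barred entry (lemma \<open>negative_excess_imp_zero_excess\<close>).

  That the index \<open>j\<close> is at least 1 uses column strictness: the \<open>r - 1\<close> entries below a box in row
  \<open>r\<close> increase strictly and are at most \<open>d\<close> (lemma \<open>val_add_row_le\<close>).
\<close>

section \<open>Contents of prefixes of a Yamanouchi word\<close>

lemma part_word_content:
  assumes "1 \<le> k" "k \<le> d"
  shows "part (word_content d w) k = count_list w k"
  using assms by (simp add: part_def word_content_def del: upt_Suc)

lemma yamanouchi_prefix_antimono:
  assumes yam: "yamanouchi d (u @ v)" and "1 \<le> i" "i \<le> j" "j \<le> d"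
  shows "count_list u j \<le> count_list u i"
  using \<open>i \<le> j\<close> \<open>j \<le> d\<close>
proof (induction j rule: dec_induct)
  case base
  show ?case by simp
next
  case (step k)
  have "part (word_content d (take (length u) (u @ v))) (k + 1)
      \<le> part (word_content d (take (length u) (u @ v))) k"
    using yam[unfolded yamanouchi_def, rule_format, of "length u" k] step.hyps step.prems \<open>1 \<le> i\<close>
    by simp
  then have "count_list u (Suc k) \<le> count_list u k"
    using step.hyps step.prems \<open>1 \<le> i\<close> by (simp add: part_word_content)
  with step show ?case by simp
qed

lemma unbarred_word_append:
  "unbarred_word L (us @ vs) = unbarred_word L us @ unbarred_word L vs"
  by (simp add: unbarred_word_def)

lemma unbarred_word_single:
  "unbarred_word L [b] = (if is_barred (L b) then [] else [val (L b)])"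
  by (cases "L b") (simp_all add: unbarred_word_def)


section \<open>The reading order\<close>

lemma partition_part_le_first:
  assumes "mu \<in> partitions d" "1 \<le> r'" "r' \<le> r" "r \<le> d"
  shows "part mu r \<le> part mu r'"
proof (cases "r' = r")
  case False
  then show ?thesis
    using assms sorted_wrt_nth_less[of "(\<ge>)" mu "r' - 1" "r - 1"]
    by (simp add: partitions_def part_def)
qed simp

lemma sorted_wrt_concat_map:
  assumes "sorted_wrt R xs"
    and "\<And>x. x \<in> set xs \<Longrightarrow> sorted_wrt S (f x)"
    and "\<And>x y u v. R x y \<Longrightarrow> u \<in> set (f x) \<Longrightarrow> v \<in> set (f y) \<Longrightarrow> S u v"
  shows "sorted_wrt S (concat (map f xs))"
  using assms(1,2)
proof (induction xs)
  case (Cons x xs)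
  then show ?case
    using assms(3) by (auto simp: sorted_wrt_append)
qed simp

lemma lower_boxI:
  assumes "1 \<le> r" "r \<le> d" "1 \<le> c" "c \<le> part mu r"
  shows "(- int r, - int c) \<in> lower_boxes d mu"
  using assms unfolding lower_boxes_def by blast

definition read_before :: "box \<Rightarrow> box \<Rightarrow> bool" where
  "read_before a b \<longleftrightarrow> snd b < snd a \<or> snd a = snd b \<and> fst a < fst b"

lemma sorted_reading_order: "sorted_wrt read_before (reading_order d lam mu)"
  unfolding reading_order_def
proof (rule sorted_wrt_concat_map)
  show "sorted_wrt (>) (rev [- int (part mu 1)..int (part lam 1)])"
    by (simp add: sorted_wrt_rev)
next
  fix q
  show "sorted_wrt read_before
     (concat (map (\<lambda>p. if (p, q) \<in> skew_boxes d lam mu then [(p, q)] else []) [- 2 * int d..- 1]))"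
    by (rule sorted_wrt_concat_map[where R = "(<)"])
      (auto simp: read_before_def split: if_splits)
qed (auto simp: read_before_def split: if_splits)

lemma lower_box_in_reading_order:
  assumes "mu \<in> partitions d" "b \<in> lower_boxes d mu"
  shows "b \<in> set (reading_order d lam mu)"
proof -
  obtain r c where b: "b = (- int r, - int c)" and rc: "1 \<le> r" "r \<le> d" "1 \<le> c" "c \<le> part mu r"
    using assms(2) by (auto simp: lower_boxes_def)
  have "c \<le> part mu 1"
    using partition_part_le_first[OF assms(1), of 1 r] rc by linarith
  then show ?thesis
    using rc assms(2) unfolding b reading_order_def skew_boxes_def by auto
qed

lemma unbarred_column_word_before_split:
  "\<exists>w. unbarred_column_word d lam mu L = unbarred_column_word_before d lam mu L b @ w"
  unfolding unbarred_column_word_def unbarred_column_word_before_def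
  by (metis takeWhile_dropWhile_id unbarred_word_append)

text \<open>
  This is where the reading order enters: as it is sorted, \<open>b\<close> cannot occur in the part that
  precedes \<open>a\<close>, so the search for \<open>b\<close> runs through that part and past \<open>a\<close>.
\<close>

lemma unbarred_column_word_before_extend:
  assumes a: "a \<in> set (reading_order d lam mu)" and ab: "read_before a b"
  shows "\<exists>w. unbarred_column_word_before d lam mu L b =
           unbarred_column_word_before d lam mu L a @ unbarred_word L [a] @ w"
proof -
  obtain us ws where R: "reading_order d lam mu = us @ a # ws" and "a \<notin> set us"
    using split_list_first[OF a] by blast
  have "b \<notin> set us"
  proof
    assume "b \<in> set us"
    moreover have "\<forall>x \<in> set us. \<forall>y \<in> set (a # ws). read_before x y"
      using sorted_reading_order[of d lam mu] unfolding R sorted_wrt_append by blast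
    ultimately have "read_before b a" by simp
    with ab show False unfolding read_before_def by linarith
  qed
  moreover have "a \<noteq> b"
    using ab by (auto simp: read_before_def)
  ultimately have "takeWhile (\<lambda>x. x \<noteq> b) (us @ a # ws) = us @ [a] @ takeWhile (\<lambda>x. x \<noteq> b) ws"
    using \<open>b \<notin> set us\<close> by (subst takeWhile_append2) auto
  moreover have "takeWhile (\<lambda>x. x \<noteq> a) (us @ a # ws) = us"
    using \<open>a \<notin> set us\<close> by (subst takeWhile_append2) auto
  ultimately show ?thesis
    unfolding unbarred_column_word_before_def R by (simp only: unbarred_word_append) blast
qed


section \<open>The excess of a box\<close>

definition excess :: "nat \<Rightarrow> nat list \<Rightarrow> nat list \<Rightarrow> filling \<Rightarrow> box \<Rightarrow> int" where
  "excess d lam mu L b =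
     int (part (word_content d (unbarred_column_word_before d lam mu L b)) (val (L b)))
     + row_num b - col_num b"

lemma c_factor_eq_excess:
  "c_factor d lam mu L b =
     (let j = dual_index d (int (val (L b))) + col_num b - row_num b
      in var_y (j + excess d lam mu L b) - var_y j)"
  by (simp add: c_factor_def excess_def Let_def algebra_simps)

lemma tableau_val_bounds:
  assumes "L \<in> skew_barred_tableaux d lam mu" "b \<in> skew_boxes d lam mu"
  shows "1 \<le> val (L b)" "val (L b) \<le> d"
proof -
  have "L b \<in> Unbarred ` {1..d} \<union> Barred ` {1..d}"
    using assms by (fastforce simp: skew_barred_tableaux_def PiE_iff split: if_splits)
  then show "1 \<le> val (L b)" "val (L b) \<le> d" by auto
qed

lemma barred_box_lower:
  assumes "L \<in> skew_barred_tableaux d lam mu" "b \<in> barred_boxes d lam mu L"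
  shows "b \<in> lower_boxes d mu"
proof (rule ccontr)
  assume "b \<notin> lower_boxes d mu"
  with assms have "b \<in> upper_boxes d lam" "b \<in> skew_boxes d lam mu"
    by (auto simp: barred_boxes_def skew_boxes_def)
  with assms(1) have "L b \<in> Unbarred ` {1..d}"
    by (fastforce simp: skew_barred_tableaux_def PiE_iff split: if_splits)
  with assms(2) show False by (auto simp: barred_boxes_def)
qed

lemma finite_barred_boxes:
  assumes "mu \<in> partitions d" "L \<in> skew_barred_tableaux d lam mu"
  shows "finite (barred_boxes d lam mu L)"
proof (rule finite_subset)
  show "barred_boxes d lam mu L \<subseteq> set (reading_order d lam mu)"
    using barred_box_lower[OF assms(2)] lower_box_in_reading_order[OF assms(1)] by blast
qed simp

text \<open>
  Descending a column from row \<open>r\<close> to row 1, the value increases at every one of the \<open>r - 1\<close> steps.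
\<close>

lemma val_add_row_le:
  assumes mu: "mu \<in> partitions d" and L: "L \<in> skew_barred_tableaux d lam mu"
    and "1 \<le> r" "r \<le> d" "1 \<le> c" "c \<le> part mu r"
  shows "val (L (- int r, - int c)) + r \<le> d + 1"
  using assms(3-)
proof (induction r rule: dec_induct)
  case base
  then have "(- int 1, - int c) \<in> skew_boxes d lam mu"
    unfolding skew_boxes_def by (intro UnI2 lower_boxI) auto
  then show ?case using tableau_val_bounds(2)[OF L] by fastforce
next
  case (step r)
  have c: "c \<le> part mu r"
    using partition_part_le_first[OF mu, of r "Suc r"] step by linarith
  have "(- int (Suc r), - int c) \<in> skew_boxes d lam mu" "(- int r, - int c) \<in> skew_boxes d lam mu"
    using c step by (auto simp only: skew_boxes_def intro!: UnI2 lower_boxI)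
  moreover have "- int (Suc r) < - int r" by simp
  ultimately have "val (L (- int (Suc r), - int c)) < val (L (- int r, - int c))"
    using L unfolding skew_barred_tableaux_def by blast
  with step.IH c step show ?case by simp
qed

text \<open>
  The column number grows by 1 from \<open>a\<close> to its left neighbour \<open>b\<close>, which costs 1; the number of
  earlier unbarred entries of the relevant value cannot drop, and gains the entry \<open>a\<close> itself when
  \<open>a\<close> is unbarred.
\<close>

lemma excess_left_neighbour:
  assumes mu: "mu \<in> partitions d" and L: "L \<in> LR d lam mu nu"
    and a: "a = (- int r, - int c)" and b: "b = (- int r, - int (Suc c))"
    and "1 \<le> r" "r \<le> d" "1 \<le> c" "Suc c \<le> part mu r"
  shows "excess d lam mu L b \<ge> excess d lam mu L a - (if is_barred (L a) then 1 else 0)"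
proof -
  have T: "L \<in> skew_barred_tableaux d lam mu"
    and Y: "yamanouchi d (unbarred_column_word d lam mu L)"
    using L by (auto simp: LR_def)
  have low: "a \<in> lower_boxes d mu" "b \<in> lower_boxes d mu"
    unfolding a b using assms(5-) by (auto simp only: intro!: lower_boxI)
  then have skew: "a \<in> skew_boxes d lam mu" "b \<in> skew_boxes d lam mu"
    by (auto simp: skew_boxes_def)
  have ord: "a \<in> set (reading_order d lam mu)"
    using low lower_box_in_reading_order[OF mu] by auto
  note va = tableau_val_bounds[OF T skew(1)] and vb = tableau_val_bounds[OF T skew(2)]
  have "- int (Suc c) < - int c" by simp
  then have le: "val (L b) \<le> val (L a)"
    using T skew unfolding skew_barred_tableaux_def a b by blast
  let ?A = "unbarred_column_word_before d lam mu L a"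
  let ?B = "unbarred_column_word_before d lam mu L b"
  have "read_before a b"
    by (simp add: read_before_def a b)
  then obtain w where w: "?B = ?A @ unbarred_word L [a] @ w"
    using unbarred_column_word_before_extend[OF ord] by blast
  obtain w' where w': "unbarred_column_word d lam mu L = ?B @ w'"
    using unbarred_column_word_before_split by blast
  have "count_list ?A (val (L a)) + (if is_barred (L a) then 0 else 1) \<le> count_list ?B (val (L a))"
    unfolding w by (simp add: unbarred_word_single)
  also have "\<dots> \<le> count_list ?B (val (L b))"
    using yamanouchi_prefix_antimono[OF Y[unfolded w'] vb(1) le va(2)] .
  finally have "count_list ?A (val (L a)) + (if is_barred (L a) then 0 else 1)
      \<le> count_list ?B (val (L b))" .
  then show ?thesis
    using va vb unfolding excess_def
    by (simp add: part_word_content row_num_def col_num_def a b split: if_splits)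
qed

text \<open>
  Induction on the column number: either the right neighbour already has negative excess, or it is
  the place where the row passes through \<open>0\<close>. In column 1 the excess is at least \<open>r - 1\<close>.
\<close>

lemma negative_excess_imp_zero_excess:
  assumes mu: "mu \<in> partitions d" and L: "L \<in> LR d lam mu nu" and r: "1 \<le> r" "r \<le> d"
    and "1 \<le> c" "c \<le> part mu r" "excess d lam mu L (- int r, - int c) < 0"
  shows "\<exists>b \<in> barred_boxes d lam mu L. excess d lam mu L b = 0"
  using assms(5-)
proof (induction c rule: dec_induct)
  case base
  then show ?case using r by (simp add: excess_def row_num_def col_num_def)
next
  case (step c)
  let ?a = "(- int r, - int c)"
  show ?case
  proof (cases "excess d lam mu L ?a < 0")
    case True
    with step show ?thesis by simp
  next
    case False
    have "excess d lam mu L (- int r, - int (Suc c))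
        \<ge> excess d lam mu L ?a - (if is_barred (L ?a) then 1 else 0)"
      using excess_left_neighbour[OF mu L refl refl r] step by blast
    with False step.prems have "is_barred (L ?a)" "excess d lam mu L ?a = 0"
      by (auto split: if_splits)
    moreover have "?a \<in> skew_boxes d lam mu"
      using lower_boxI[OF r, of c] step by (simp add: skew_boxes_def)
    ultimately show ?thesis by (auto simp: barred_boxes_def)
  qed
qed


section \<open>Nonnegativity\<close>

theorem proposition2p7:
  fixes d :: nat and lam mu nu :: "nat list" and L :: filling
  assumes "d \<ge> 1"
    and "lam \<in> partitions d" and "mu \<in> partitions d" and "nu \<in> partitions d"
    and "L \<in> LR d lam mu nu"
  shows "c_nonneg d lam mu L"
proof (cases "\<exists>b \<in> barred_boxes d lam mu L. excess d lam mu L b = 0")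
  case True
  then have "\<exists>b \<in> barred_boxes d lam mu L. c_factor d lam mu L b = 0"
    by (elim bexE, intro bexI) (simp_all add: c_factor_eq_excess Let_def)
  moreover have "finite (barred_boxes d lam mu L)"
    using finite_barred_boxes assms by (auto simp: LR_def)
  ultimately have "c_poly d lam mu L = 0"
    unfolding c_poly_def by (intro prod_zero) auto
  then show ?thesis by (simp add: c_nonneg_def)
next
  case False
  have T: "L \<in> skew_barred_tableaux d lam mu"
    using assms(5) by (simp add: LR_def)
  have "c_positive d lam mu L"
    unfolding c_positive_def
  proof
    fix b assume b: "b \<in> barred_boxes d lam mu L"
    obtain r c where rc: "b = (- int r, - int c)" "1 \<le> r" "r \<le> d" "1 \<le> c" "c \<le> part mu r"
      using barred_box_lower[OF T b] unfolding lower_boxes_def by blast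
    have "excess d lam mu L b > 0"
      using negative_excess_imp_zero_excess[OF assms(3,5) rc(2-)] False b rc(1)
      by (metis linorder_neqE_linordered_idom)
    moreover have "1 \<le> dual_index d (int (val (L b))) + col_num b - row_num b"
      using val_add_row_le[OF assms(3) T rc(2-)] rc(1,4)
      by (simp add: dual_index_def col_num_def row_num_def)
    ultimately show "\<exists>i j. 1 \<le> j \<and> j < i \<and> c_factor d lam mu L b = var_y i - var_y j"
      unfolding c_factor_eq_excess Let_def by (metis less_add_same_cancel1)
  qed
  then show ?thesis by (simp add: c_nonneg_def)
qed

end
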